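(* In the Kronecker model described in the context, consider the action of $g_1\in\mathcal G_L(k)$ on the sample space, $g_1\circ(R_0,\Omega_0,\Phi)=(g_1R_0,\Omega_0,g_1\Phi g_1')$, and on the parameter space, $g_1\circ(\Delta,\mu,\Omega_0,\Phi)=(\Delta,g_1\mu,\Omega_0,g_1\Phi g_1')$. For these group actions: (i) the maximal invariant in the sample space is given by $(Q,\Omega_0)$, where $Q=[S:T]'[S:T]$; and (ii) the maximal invariant in the parameter space is given by $(c_\beta^2\lambda,\;c_\beta d_\beta\lambda,\;d_\beta^2\lambda,\;\Omega_0)$.
   Context: Model: fix $\beta_0\in\mathbb R$ and let $B_0=\begin{pmatrix}1&0\\-\beta_0&1\end{pmatrix}$, $a_0=(\beta_0,1)'$, $b_0=(1,-\beta_0)'$. $R$ is a random $k\times2$ matrix with $\mathrm{vec}(R)\sim N(a\otimes\mu,\Omega\otimes\Phi)$, where $a=(\beta,1)'$, $\beta\in\mathbb R$, $\mu\in\mathbb R^k$, $\Omega$ is a $2\times2$ and $\Phi$ a $k\times k$ positive definite matrix. Put $R_0=RB_0$, $\Omega_0=B_0'\Omega B_0$, $\Delta=\beta-\beta_0$, so that $\mathrm{vec}(R_0)\sim N((\Delta,1)'\otimes\mu,\Omega_0\otimes\Phi)$. The matrices $\Omega_0,\Phi$ are known but not fixed: the data are $(R_0,\Omega_0,\Phi)$ and the parameters are $(\Delta,\mu,\Omega_0,\Phi)$. Statistics: $S=\Phi^{-1/2}Rb_0\,(b_0'\Omega b_0)^{-1/2}$ and $T=\Phi^{-1/2}R\,\Omega^{-1}a_0\,(a_0'\Omega^{-1}a_0)^{-1/2}$.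 Parameter functions: $c_\beta=(\beta-\beta_0)(b_0'\Omega b_0)^{-1/2}$, $d_\beta=a'\Omega^{-1}a_0\,(a_0'\Omega^{-1}a_0)^{-1/2}$, $\lambda=\mu'\Phi^{-1}\mu$. (Thus $S\sim N(c_\beta\Phi^{-1/2}\mu,I_k)$, $T\sim N(d_\beta\Phi^{-1/2}\mu,I_k)$.) $\mathcal G_L(k)$ is the group of invertible $k\times k$ real matrices. A function on a space with a group action is a maximal invariant if it is constant on orbits and takes different values on different orbits (so that any other invariant function is a function of it).
   Formalization: In (ii), maximality is stated for μ ≠ 0, since at μ = 0 the vector is (0,0,0,Ω₀) for every Δ while the action fixes Δ; on the full parameter space, invariance holds and equal values mean same orbit up to equal data distribution (mean matrix, Ω₀, Φ). *)

theory Defs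
  imports "HOL-Analysis.Analysis" "HOL-Algebra.Group_Action"
begin

definition pos_def :: "real^'n^'n \<Rightarrow> bool" where
  "pos_def A \<longleftrightarrow> transpose A = A \<and> (\<forall>x. x \<noteq> 0 \<longrightarrow> 0 < x \<bullet> (A *v x))"

text \<open>The symmetric inverse square root: for positive definite \<open>A\<close> there is exactly one such \<open>B\<close>.\<close>

definition inv_sqrt :: "real^'n^'n \<Rightarrow> real^'n^'n" where
  "inv_sqrt A = (THE B. pos_def B \<and> B ** B = matrix_inv A)"

definition B0 :: "real \<Rightarrow> real^2^2" where
  "B0 \<beta>0 = vector [vector [1, 0], vector [- \<beta>0, 1]]"

definition a_vec :: "real \<Rightarrow> real^2" where
  "a_vec \<beta> = vector [\<beta>, 1]"

definition b_vec :: "real \<Rightarrow> real^2" where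
  "b_vec \<beta> = vector [1, - \<beta>]"

text \<open>A \<open>k \<times> 2\<close> matrix has type \<open>real^2^'k\<close>.\<close>

definition S_stat :: "real \<Rightarrow> real^2^'k \<Rightarrow> real^2^2 \<Rightarrow> real^'k^'k \<Rightarrow> real^'k" where
  "S_stat \<beta>0 R \<Omega> \<Phi> =
     (1 / sqrt (b_vec \<beta>0 \<bullet> (\<Omega> *v b_vec \<beta>0))) *\<^sub>R (inv_sqrt \<Phi> *v (R *v b_vec \<beta>0))"

definition T_stat :: "real \<Rightarrow> real^2^'k \<Rightarrow> real^2^2 \<Rightarrow> real^'k^'k \<Rightarrow> real^'k" where
  "T_stat \<beta>0 R \<Omega> \<Phi> =
     (1 / sqrt (a_vec \<beta>0 \<bullet> (matrix_inv \<Omega> *v a_vec \<beta>0))) *\<^sub>R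
       (inv_sqrt \<Phi> *v (R *v (matrix_inv \<Omega> *v a_vec \<beta>0)))"

definition ST_stat :: "real \<Rightarrow> real^2^'k \<Rightarrow> real^2^2 \<Rightarrow> real^'k^'k \<Rightarrow> real^2^'k" where
  "ST_stat \<beta>0 R \<Omega> \<Phi> = (\<chi> i j. if j = 1 then S_stat \<beta>0 R \<Omega> \<Phi> $ i else T_stat \<beta>0 R \<Omega> \<Phi> $ i)"

definition Q_stat :: "real \<Rightarrow> real^2^'k \<Rightarrow> real^2^2 \<Rightarrow> real^'k^'k \<Rightarrow> real^2^2" where
  "Q_stat \<beta>0 R \<Omega> \<Phi> = transpose (ST_stat \<beta>0 R \<Omega> \<Phi>) ** ST_stat \<beta>0 R \<Omega> \<Phi>"

definition c_par :: "real \<Rightarrow> real \<Rightarrow> real^2^2 \<Rightarrow> real" where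
  "c_par \<beta>0 \<beta> \<Omega> = (\<beta> - \<beta>0) / sqrt (b_vec \<beta>0 \<bullet> (\<Omega> *v b_vec \<beta>0))"

definition d_par :: "real \<Rightarrow> real \<Rightarrow> real^2^2 \<Rightarrow> real" where
  "d_par \<beta>0 \<beta> \<Omega> =
     (a_vec \<beta> \<bullet> (matrix_inv \<Omega> *v a_vec \<beta>0)) / sqrt (a_vec \<beta>0 \<bullet> (matrix_inv \<Omega> *v a_vec \<beta>0))"

definition lambda_par :: "real^'k \<Rightarrow> real^'k^'k \<Rightarrow> real" where
  "lambda_par \<mu> \<Phi> = \<mu> \<bullet> (matrix_inv \<Phi> *v \<mu>)"

text \<open>Sample points are \<open>(R\<^sub>0, \<Omega>\<^sub>0, \<Phi>)\<close>, parameter points are \<open>(\<Delta>, \<mu>, \<Omega>\<^sub>0, \<Phi>)\<close>. The statistics and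
  parameter functions above are expressed in \<open>(R, \<Omega>, \<beta>)\<close>; these are recovered by inverting
  \<open>R\<^sub>0 = R B\<^sub>0\<close>, \<open>\<Omega>\<^sub>0 = B\<^sub>0' \<Omega> B\<^sub>0\<close>, \<open>\<Delta> = \<beta> - \<beta>\<^sub>0\<close>.\<close>

definition R_of :: "real \<Rightarrow> real^2^'k \<Rightarrow> real^2^'k" where
  "R_of \<beta>0 R0 = R0 ** matrix_inv (B0 \<beta>0)"

definition Omega_of :: "real \<Rightarrow> real^2^2 \<Rightarrow> real^2^2" where
  "Omega_of \<beta>0 \<Omega>0 = transpose (matrix_inv (B0 \<beta>0)) ** \<Omega>0 ** matrix_inv (B0 \<beta>0)"

type_synonym 'k sample = "(real^2^'k) \<times> (real^2^2) \<times> (real^'k^'k)"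
type_synonym 'k param = "real \<times> (real^'k) \<times> (real^2^2) \<times> (real^'k^'k)"

definition sample_space :: "'k::finite sample set" where
  "sample_space = {(R0, \<Omega>0, \<Phi>). pos_def \<Omega>0 \<and> pos_def \<Phi>}"

definition param_space :: "'k::finite param set" where
  "param_space = {(\<Delta>, \<mu>, \<Omega>0, \<Phi>). pos_def \<Omega>0 \<and> pos_def \<Phi>}"

text \<open>On all of \<open>param_space\<close> the four-component function below is not maximal: it is
  \<open>(0, 0, 0, \<Omega>\<^sub>0)\<close> whenever \<open>\<mu> = 0\<close>, although the action fixes \<open>\<Delta>\<close>.\<close>

definition param_space_nonzero :: "'k::finite param set" where
  "param_space_nonzero = {(\<Delta>, \<mu>, \<Omega>0, \<Phi>). \<mu> \<noteq> 0 \<and> pos_def \<Omega>0 \<and> pos_def \<Phi>}"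

definition GL :: "(real^'k^'k) monoid" where
  "GL = \<lparr>carrier = {g. invertible g}, mult = (**), one = mat 1\<rparr>"

text \<open>The restrictions make the maps extensional, as the library's \<open>group_action\<close> requires.\<close>

definition sample_action :: "real^'k^'k \<Rightarrow> 'k::finite sample \<Rightarrow> 'k sample" where
  "sample_action g = restrict (\<lambda>(R0, \<Omega>0, \<Phi>). (g ** R0, \<Omega>0, g ** \<Phi> ** transpose g)) sample_space"

definition param_map :: "real^'k^'k \<Rightarrow> 'k::finite param \<Rightarrow> 'k param" where
  "param_map g = (\<lambda>(\<Delta>, \<mu>, \<Omega>0, \<Phi>). (\<Delta>, g *v \<mu>, \<Omega>0, g ** \<Phi> ** transpose g))"

definition param_action_on :: "'k::finite param set \<Rightarrow> real^'k^'k \<Rightarrow> 'k param \<Rightarrow> 'k param" where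
  "param_action_on E g = restrict (param_map g) E"

definition sample_invariant :: "real \<Rightarrow> 'k::finite sample \<Rightarrow> (real^2^2) \<times> (real^2^2)" where
  "sample_invariant \<beta>0 = (\<lambda>(R0, \<Omega>0, \<Phi>). (Q_stat \<beta>0 (R_of \<beta>0 R0) (Omega_of \<beta>0 \<Omega>0) \<Phi>, \<Omega>0))"

definition param_invariant :: "real \<Rightarrow> 'k::finite param \<Rightarrow> real \<times> real \<times> real \<times> (real^2^2)" where
  "param_invariant \<beta>0 = (\<lambda>(\<Delta>, \<mu>, \<Omega>0, \<Phi>).
     (let \<beta> = \<beta>0 + \<Delta>; \<Omega> = Omega_of \<beta>0 \<Omega>0;
          c = c_par \<beta>0 \<beta> \<Omega>; d = d_par \<beta>0 \<beta> \<Omega>; l = lambda_par \<mu> \<Phi>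
      in (c\<^sup>2 * l, c * d * l, d\<^sup>2 * l, \<Omega>0)))"

text \<open>At parameter \<open>(\<Delta>, \<mu>, \<Omega>\<^sub>0, \<Phi>)\<close>, \<open>vec(R\<^sub>0)\<close> is normal with mean \<open>(\<Delta>, 1)' \<otimes> \<mu>\<close>, i.e. \<open>R\<^sub>0\<close> has mean
  matrix \<open>\<mu> (\<Delta>, 1)\<close>, and covariance \<open>\<Omega>\<^sub>0 \<otimes> \<Phi>\<close>, where \<open>\<Omega>\<^sub>0\<close> and \<open>\<Phi>\<close> are observed. So the distribution
  of the data \<open>(R\<^sub>0, \<Omega>\<^sub>0, \<Phi>)\<close> is specified by the following triple. It determines
  the parameter when \<open>\<mu> \<noteq> 0\<close>; when \<open>\<mu> = 0\<close> it does not depend on \<open>\<Delta>\<close>, so \<open>\<Delta>\<close> is not identified.\<close>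

definition data_law_spec :: "'k::finite param \<Rightarrow> (real^2^'k) \<times> (real^2^2) \<times> (real^'k^'k)" where
  "data_law_spec = (\<lambda>(\<Delta>, \<mu>, \<Omega>0, \<Phi>). (\<chi> i j. \<mu> $ i * (vector [\<Delta>, 1] :: real^2) $ j, \<Omega>0, \<Phi>))"

definition constant_on_orbits :: "('g, 'm) monoid_scheme \<Rightarrow> 'x set \<Rightarrow> ('g \<Rightarrow> 'x \<Rightarrow> 'x) \<Rightarrow> ('x \<Rightarrow> 'v) \<Rightarrow> bool"
  where
  "constant_on_orbits G E \<phi> f \<longleftrightarrow> (\<forall>X \<in> orbits G E \<phi>. \<forall>x\<in>X. \<forall>y\<in>X. f x = f y)"

definition maximal_invariant :: "('g, 'm) monoid_scheme \<Rightarrow> 'x set \<Rightarrow> ('g \<Rightarrow> 'x \<Rightarrow> 'x) \<Rightarrow> ('x \<Rightarrow> 'v) \<Rightarrow> bool"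
  where
  "maximal_invariant G E \<phi> f \<longleftrightarrow>
     constant_on_orbits G E \<phi> f \<and>
     (\<forall>X \<in> orbits G E \<phi>. \<forall>Y \<in> orbits G E \<phi>. X \<noteq> Y \<longrightarrow> (\<forall>x\<in>X. \<forall>y\<in>Y. f x \<noteq> f y))"

end

theory Submission
  imports Defs
begin

text \<open>Every \<open>k \<times> 2\<close> matrix \<open>R\<close> is determined by \<open>R b\<^sub>0\<close> and \<open>R \<Omega>\<inverse> a\<^sub>0\<close>, since \<open>b\<^sub>0\<close> and \<open>\<Omega>\<inverse> a\<^sub>0\<close> are
  \<open>\<Omega>\<close>-orthogonal, and the entries of \<open>Q\<close> are the suitably normalised Gram matrix of these two
  vectors in the inner product \<open>x' \<Phi>\<inverse> y\<close>, which the group preserves. Conversely, two pairs of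
  vectors with the same Gram matrix differ by an orthogonal map, here a product of two Householder
  reflections; conjugating it with the square roots of the two matrices \<open>\<Phi>\<close> gives the group
  element. For the parameters, the invariant lists the entries of \<open>Q\<close> evaluated at the mean
  matrix \<open>\<mu> (\<Delta>, 1)\<close>, on which the group acts as on the sample space, so part (ii) is
  part (i) at the mean matrices.\<close>

section \<open>Square roots of positive definite matrices\<close>

lemma nonpos_if_quadratic_bound:
  fixes a b :: real
  assumes "\<And>t. 2 * t * a \<le> t\<^sup>2 * b"
  shows "a \<le> 0"
proof (rule ccontr)
  assume "\<not> a \<le> 0"
  then have a: "a > 0" by simp
  \<comment> \<open>A positive \<open>t\<close> so small that \<open>t * b \<le> a\<close>; the
    bound divided by \<open>t\<close> then gives \<open>2 * a \<le> a\<close>.\<close>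
  define t where "t = a / (\<bar>b\<bar> + 1)"
  have t: "t > 0" using a by (simp add: t_def)
  have "2 * a \<le> t * b"
    using assms[of t] t by (simp add: power2_eq_square mult.assoc mult.left_commute)
  also have "\<dots> \<le> t * (\<bar>b\<bar> + 1)"
    using t by (intro mult_left_mono) auto
  also have "\<dots> = a" by (simp add: t_def)
  finally show False using a by simp
qed

text \<open>A maximiser \<open>v\<close> of the Rayleigh quotient over the unit sphere of
  \<open>V\<close> is an eigenvector: moving \<open>v\<close> against the residual
  \<open>c *\<^sub>R v - f v\<close> would increase the quotient unless the residual
  vanishes.\<close>

lemma selfadjoint_eigenvector_exists:
  fixes f :: "'a::euclidean_space \<Rightarrow> 'a"
  assumes f: "linear f" and sa: "\<And>x y. f x \<bullet> y = x \<bullet> f y"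
    and V: "subspace V" and inv: "\<And>x. x \<in> V \<Longrightarrow> f x \<in> V" and nz: "V \<noteq> {0}"
  obtains v c where "v \<in> V" "norm v = 1" "f v = c *\<^sub>R v"
proof -
  interpret f: linear f by (rule f)
  let ?K = "sphere 0 1 \<inter> V"
  have cont: "continuous_on A f" for A
    by (simp add: f linear_continuous_on linear_linear)
  have "compact ?K"
    by (intro compact_Int_closed closed_subspace V) simp
  moreover obtain x where x: "x \<in> V" "x \<noteq> 0"
    using nz subspace_0[OF V] by blast
  then have "(1 / norm x) *\<^sub>R x \<in> ?K"
    using V by (simp add: subspace_scale)
  then have "?K \<noteq> {}" by blast
  moreover have "continuous_on ?K (\<lambda>x. x \<bullet> f x)"
    by (intro continuous_intros cont)
  ultimately obtain v where v: "v \<in> ?K" and max: "\<And>y. y \<in> ?K \<Longrightarrow> y \<bullet> f y \<le> v \<bullet> f v"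
    using continuous_attains_sup[of ?K "\<lambda>x. x \<bullet> f x"] by blast
  define c where "c = v \<bullet> f v"
  have vv: "v \<bullet> v = 1" using v by (simp add: dot_square_norm)
  have le: "x \<bullet> f x \<le> c * (x \<bullet> x)" if "x \<in> V" for x
  proof (cases "x = 0")
    case False
    have "((1 / norm x) *\<^sub>R x) \<bullet> f ((1 / norm x) *\<^sub>R x) \<le> c"
      unfolding c_def by (rule max) (use that False V in \<open>simp add: subspace_scale\<close>)
    then have "(x \<bullet> f x) / (norm x)\<^sup>2 \<le> c"
      by (simp add: f.scale power2_eq_square)
    then show ?thesis
      using False by (simp add: divide_le_eq dot_square_norm)
  qed (simp add: f.zero)
  \<comment> \<open>Half the gradient at \<open>v\<close> of the form
    \<open>c * (x \<bullet> x) - x \<bullet> f x\<close>, which is nonnegative on \<open>V\<close>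
    and zero at \<open>v\<close>.\<close>
  define w where "w = c *\<^sub>R v - f v"
  have wV: "w \<in> V"
    using v V inv by (auto simp: w_def intro!: subspace_diff subspace_scale)
  \<comment> \<open>Nonnegativity of that form at \<open>v - t *\<^sub>R w\<close>, expanded in
    powers of \<open>t\<close>; the constant term is its value at \<open>v\<close>, which is
    zero.\<close>
  have "2 * t * (w \<bullet> w) \<le> t\<^sup>2 * (c * (w \<bullet> w) - w \<bullet> f w)" for t
  proof -
    have "v - t *\<^sub>R w \<in> V" using v V wV by (auto intro!: subspace_diff subspace_scale)
    from le[OF this]
    have "v \<bullet> f v - t * (v \<bullet> f w) - t * (w \<bullet> f v) + t\<^sup>2 * (w \<bullet> f w)
        \<le> c * (v \<bullet> v - 2 * t * (v \<bullet> w) + t\<^sup>2 * (w \<bullet> w))"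
      by (simp add: f.diff f.scale inner_simps inner_commute power2_eq_square algebra_simps)
    moreover have "v \<bullet> f w = w \<bullet> f v" using sa[of v w] by (simp add: inner_commute)
    moreover have ww: "w \<bullet> w = c * (v \<bullet> w) - w \<bullet> f v"
      by (subst (2) w_def) (simp add: inner_simps inner_commute)
    have "2 * t * (w \<bullet> w) = 2 * t * (c * (v \<bullet> w)) - 2 * t * (w \<bullet> f v)"
      by (subst ww) (simp add: algebra_simps)
    ultimately show ?thesis
      using vv by (simp add: c_def[symmetric] algebra_simps)
  qed
  then have "w \<bullet> w \<le> 0" by (rule nonpos_if_quadratic_bound)
  then have "w = 0" by (metis inner_eq_zero_iff inner_ge_zero order_antisym)
  then have "f v = c *\<^sub>R v" by (simp add: w_def)
  then show ?thesis using that v by auto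
qed

text \<open>Induction on the dimension of \<open>V\<close>: a unit eigenvector \<open>v\<close> is
  split off, and its orthogonal complement in \<open>V\<close> is again invariant because
  \<open>v \<bullet> f x = f v \<bullet> x = c * (v \<bullet> x)\<close>.\<close>

lemma selfadjoint_eigenbasis_on:
  fixes f :: "'a::euclidean_space \<Rightarrow> 'a"
  assumes f: "linear f" and sa: "\<And>x y. f x \<bullet> y = x \<bullet> f y"
  shows "subspace V \<Longrightarrow> (\<And>x. x \<in> V \<Longrightarrow> f x \<in> V) \<Longrightarrow>
    \<exists>B. B \<subseteq> V \<and> finite B \<and> span B = V \<and> pairwise orthogonal B \<and>
      (\<forall>b\<in>B. norm b = 1 \<and> (\<exists>c. f b = c *\<^sub>R b))"
proof (induction "dim V" arbitrary: V rule: less_induct)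
  case less
  show ?case
  proof (cases "V = {0}")
    case True
    then show ?thesis by (intro exI[of _ "{}"]) auto
  next
    case False
    obtain v c where v: "v \<in> V" "norm v = 1" "f v = c *\<^sub>R v"
      using selfadjoint_eigenvector_exists[OF f sa less.prems False] by blast
    have vv: "v \<bullet> v = 1" using v by (simp add: dot_square_norm)
    define W where "W = {x \<in> V. v \<bullet> x = 0}"
    have W: "subspace W"
      using less.prems(1) by (auto simp: W_def subspace_def inner_simps)
    have WV: "W \<subseteq> V" by (auto simp: W_def)
    have "v \<notin> W" using vv by (simp add: W_def)
    then have "W \<subset> V" using WV v by blast
    then have "dim W < dim V"
      using W less.prems(1) by (metis dim_psubset span_eq_iff)
    moreover have "f x \<in> W" if "x \<in> W" for x
      using that less.prems(2)[of x] sa[of v x] v by (simp add: W_def)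
    ultimately obtain B where B: "B \<subseteq> W" "finite B" "span B = W" "pairwise orthogonal B"
        "\<forall>b\<in>B. norm b = 1 \<and> (\<exists>c. f b = c *\<^sub>R b)"
      using less.hyps[of W] W by blast
    have "x \<in> span (insert v B)" if "x \<in> V" for x
    proof -
      have "x - (v \<bullet> x) *\<^sub>R v \<in> W"
        using that v vv less.prems(1)
        by (auto simp: W_def inner_simps intro!: subspace_diff subspace_scale)
      then show ?thesis using B(3) span_breakdown_eq by blast
    qed
    moreover have "span (insert v B) \<subseteq> V"
      using B v WV less.prems(1) by (intro span_minimal) auto
    ultimately have "span (insert v B) = V" by blast
    moreover have "pairwise orthogonal (insert v B)"
      using B(1,4) by (auto simp: pairwise_insert W_def orthogonal_def inner_commute)
    ultimately show ?thesis
      using B v WV by (intro exI[of _ "insert v B"]) auto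
  qed
qed

lemma symmetric_matrix_selfadjoint:
  fixes A :: "real^'n^'n"
  assumes "transpose A = A"
  shows "(A *v x) \<bullet> y = x \<bullet> (A *v y)"
  by (metis assms dot_lmul_matrix transpose_matrix_vector)

lemma selfadjoint_matrix_symmetric:
  fixes A :: "real^'n^'n"
  assumes "\<And>x y. (A *v x) \<bullet> y = x \<bullet> (A *v y)"
  shows "transpose A = A"
proof -
  have "(transpose A *v x) \<bullet> y = (A *v x) \<bullet> y" for x y
    by (simp add: assms dot_lmul_matrix)
  then show ?thesis by (metis matrix_eq vector_eq_rdot)
qed

lemma symmetric_matrix_eigenbasis:
  fixes A :: "real^'n^'n"
  assumes "transpose A = A"
  obtains B c where "finite B" "span B = UNIV" "pairwise orthogonal B"
    "\<And>b. b \<in> B \<Longrightarrow> norm b = 1" "\<And>b. b \<in> B \<Longrightarrow> A *v b = c b *\<^sub>R b"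
proof -
  have "\<exists>B. B \<subseteq> UNIV \<and> finite B \<and> span B = UNIV \<and> pairwise orthogonal B \<and>
      (\<forall>b\<in>B. norm b = 1 \<and> (\<exists>c. A *v b = c *\<^sub>R b))"
    by (rule selfadjoint_eigenbasis_on) (auto simp: symmetric_matrix_selfadjoint[OF assms])
  then show ?thesis using that by metis
qed

section \<open>Existence and uniqueness of positive definite square roots\<close>

lemma pos_def_symmetric: "pos_def A \<Longrightarrow> transpose A = A"
  by (simp add: pos_def_def)

lemma pos_def_pos: "pos_def A \<Longrightarrow> x \<noteq> 0 \<Longrightarrow> 0 < x \<bullet> (A *v x)"
  by (simp add: pos_def_def)

lemma pos_def_sqrt_exists:
  fixes A :: "real^'n^'n"
  assumes A: "pos_def A"
  shows "\<exists>B. pos_def B \<and> B ** B = A"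
proof -
  obtain B c where B: "finite B" "span B = UNIV" "pairwise orthogonal B"
    and n: "\<And>b. b \<in> B \<Longrightarrow> norm b = 1" and c: "\<And>b. b \<in> B \<Longrightarrow> A *v b = c b *\<^sub>R b"
    using symmetric_matrix_eigenbasis[OF pos_def_symmetric[OF A]] by blast
  have cpos: "c b > 0" if "b \<in> B" for b
  proof -
    have "b \<noteq> 0" using n[OF that] by auto
    from pos_def_pos[OF A this] show ?thesis
      using n[OF that] c[OF that] by (simp add: dot_square_norm)
  qed
  \<comment> \<open>The map that scales each eigenvector \<open>b\<close> by
    \<open>sqrt (c b)\<close>, written as a sum over rank-one projections so that linearity and
    symmetry can be read off.\<close>
  define s where "s = (\<lambda>x. \<Sum>b\<in>B. (sqrt (c b) * (b \<bullet> x)) *\<^sub>R b)"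
  have s: "linear s"
    by (rule linearI)
      (simp_all add: s_def inner_simps algebra_simps sum.distrib scaleR_sum_right)
  let ?S = "matrix s"
  have S: "?S *v x = s x" for x using s by (simp add: matrix_works)
  have bb: "b \<bullet> b' = (if b = b' then 1 else 0)" if "b \<in> B" "b' \<in> B" for b b'
    using B(3) that n by (auto simp: pairwise_def orthogonal_def dot_square_norm)
  have sb: "s b = sqrt (c b) *\<^sub>R b" if "b \<in> B" for b
  proof -
    have "s b = (\<Sum>b'\<in>B. if b' = b then sqrt (c b) *\<^sub>R b else 0)"
      unfolding s_def by (rule sum.cong) (auto simp: bb that)
    then show ?thesis using B(1) that by simp
  qed
  have "(?S ** ?S) *v x = A *v x" for x
  proof -
    have "(?S ** ?S) *v b = A *v b" if b: "b \<in> B" for b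
      using cpos[OF b] s
      by (simp add: matrix_vector_mul_assoc[symmetric] S sb b c linear_scale)
    then show ?thesis
      using B(2) linear_eq_on_span[OF matrix_vector_mul_linear matrix_vector_mul_linear,
          of B "?S ** ?S" A x] by simp
  qed
  then have SS: "?S ** ?S = A" by (simp add: matrix_eq)
  have quad: "x \<bullet> s y = (\<Sum>b\<in>B. sqrt (c b) * (b \<bullet> x) * (b \<bullet> y))" for x y
    by (simp add: s_def inner_sum_right inner_commute algebra_simps)
  have "transpose ?S = ?S"
    by (rule selfadjoint_matrix_symmetric)
      (simp add: S inner_commute[of "s _"] quad mult.assoc mult.commute mult.left_commute)
  moreover have "0 < x \<bullet> (?S *v x)" if "x \<noteq> 0" for x
  proof -
    \<comment> \<open>A vector orthogonal to the spanning set \<open>B\<close> is orthogonal to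
      itself.\<close>
    have "\<exists>b\<in>B. b \<bullet> x \<noteq> 0"
    proof (rule ccontr)
      assume "\<not> ?thesis"
      then have "orthogonal x y" if "y \<in> span B" for y
        using orthogonal_to_span[OF that, of x] by (auto simp: orthogonal_def inner_commute)
      then have "x \<bullet> x = 0" by (simp add: B(2) orthogonal_def)
      then show False using \<open>x \<noteq> 0\<close> by simp
    qed
    then obtain b where b: "b \<in> B" "b \<bullet> x \<noteq> 0" by blast
    have "0 < (\<Sum>b\<in>B. sqrt (c b) * (b \<bullet> x)\<^sup>2)"
      using b cpos by (intro sum_pos2[OF B(1) b(1)]) (auto simp: less_imp_le)
    then show ?thesis by (simp add: S quad power2_eq_square mult.assoc)
  qed
  ultimately show ?thesis using SS by (auto simp: pos_def_def)
qed

text \<open>Let \<open>b\<close> be an eigenvector of \<open>B - C\<close> with eigenvalue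
  \<open>m\<close>. The product \<open>(B b - C b) \<bullet> (B b + C b)\<close> is a difference of
  equal squared norms, hence zero; it also equals \<open>m\<close> times a positive number. So
  \<open>B - C\<close> vanishes on an eigenbasis.\<close>

lemma pos_def_sqrt_unique:
  fixes B C :: "real^'n^'n"
  assumes B: "pos_def B" and C: "pos_def C" and eq: "B ** B = C ** C"
  shows "B = C"
proof -
  have sB: "transpose B = B" and sC: "transpose C = C"
    using B C by (auto simp: pos_def_symmetric)
  have "transpose (B - C) = B - C"
    using sB sC by (simp add: transpose_def vec_eq_iff)
  then obtain E m where "finite E" "pairwise orthogonal E"
    and E: "span E = UNIV" "\<And>b. b \<in> E \<Longrightarrow> norm b = 1"
      "\<And>b. b \<in> E \<Longrightarrow> (B - C) *v b = m b *\<^sub>R b"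
    by (rule symmetric_matrix_eigenbasis) (rule that)
  have "(B - C) *v b = 0" if b: "b \<in> E" for b
  proof -
    have "b \<noteq> 0" using E(2)[OF b] by auto
    have "(B *v b) \<bullet> (B *v b) = (C *v b) \<bullet> (C *v b)"
      by (simp add: symmetric_matrix_selfadjoint[OF sB] symmetric_matrix_selfadjoint[OF sC]
          matrix_vector_mul_assoc eq)
    then have "(B *v b - C *v b) \<bullet> (B *v b + C *v b) = 0"
      by (simp add: inner_simps inner_commute)
    moreover have "B *v b - C *v b = m b *\<^sub>R b"
      using E(3)[OF b] by (simp add: matrix_vector_mult_diff_rdistrib)
    ultimately have "m b * (b \<bullet> (B *v b) + b \<bullet> (C *v b)) = 0"
      by (metis inner_add_right inner_scaleR_left)
    moreover have "0 < b \<bullet> (B *v b) + b \<bullet> (C *v b)"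
      using pos_def_pos[OF B \<open>b \<noteq> 0\<close>] pos_def_pos[OF C \<open>b \<noteq> 0\<close>] by simp
    ultimately have "m b = 0" by simp
    then show ?thesis using E(3)[OF b] by simp
  qed
  then have "(B - C) *v x = 0" for x
    using linear_eq_0_on_span[OF matrix_vector_mul_linear, of E "B - C" x] E(1) by simp
  then show ?thesis
    by (metis eq_iff_diff_eq_0 matrix_eq matrix_vector_mult_0)
qed

section \<open>Matrix inverses, congruences and the inverse square root\<close>

lemma matrix_inv_inverse:
  assumes "invertible A"
  shows "A ** matrix_inv A = mat 1" "matrix_inv A ** A = mat 1"
proof -
  have "A ** matrix_inv A = mat 1 \<and> matrix_inv A ** A = mat 1"
    \<comment> \<open>\<open>matrix_inv\<close> is a Hilbert choice; invertibility supplies the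
      witness.\<close>
    unfolding matrix_inv_def by (rule someI_ex) (use assms in \<open>simp add: invertible_def\<close>)
  then show "A ** matrix_inv A = mat 1" "matrix_inv A ** A = mat 1" by auto
qed

lemma matrix_inv_vector:
  assumes "invertible A"
  shows "A *v (matrix_inv A *v x) = x" "matrix_inv A *v (A *v x) = x"
  by (simp_all add: matrix_vector_mul_assoc matrix_inv_inverse[OF assms])

lemma matrix_inv_unique:
  fixes A :: "'a::field^'n^'n"
  assumes "B ** A = mat 1"
  shows "matrix_inv A = B"
proof -
  have "invertible A" using assms invertible_left_inverse by blast
  then show ?thesis
    by (metis assms matrix_inv_inverse(1) matrix_mul_assoc matrix_mul_lid matrix_mul_rid)
qed

lemma invertible_matrix_inv: "invertible A \<Longrightarrow> invertible (matrix_inv A)"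
  by (metis invertible_def matrix_inv_inverse)

lemma pos_def_invertible:
  fixes A :: "real^'n^'n"
  assumes "pos_def A"
  shows "invertible A"
proof -
  have "x = 0" if "A *v x = 0" for x
    using pos_def_pos[OF assms, of x] that by auto
  then show ?thesis
    using matrix_left_invertible_ker[of A] invertible_left_inverse[of A] by blast
qed

text \<open>The quadratic form at \<open>x\<close> is that of \<open>A\<close> at
  \<open>transpose g *v x\<close>, and \<open>transpose g\<close> has trivial kernel.\<close>

lemma pos_def_congruence:
  fixes A g :: "real^'n^'n"
  assumes A: "pos_def A" and g: "invertible g"
  shows "pos_def (g ** A ** transpose g)"
proof -
  have "transpose (g ** A ** transpose g) = g ** A ** transpose g"
    by (simp add: matrix_transpose_mul pos_def_symmetric[OF A] matrix_mul_assoc)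
  moreover have "0 < x \<bullet> ((g ** A ** transpose g) *v x)" if "x \<noteq> 0" for x
  proof -
    have "transpose g *v x \<noteq> 0"
      by (metis g transpose_invertible matrix_inv_vector(2) matrix_vector_mult_0_right that)
    from pos_def_pos[OF A this] show ?thesis
      by (simp add: matrix_vector_mul_assoc[symmetric] dot_lmul_matrix)
  qed
  ultimately show ?thesis by (simp add: pos_def_def)
qed

text \<open>Evaluating the form of \<open>A\<close> at \<open>matrix_inv A *v x\<close> gives the
  form of the inverse at \<open>x\<close>.\<close>

lemma pos_def_matrix_inv:
  fixes A :: "real^'n^'n"
  assumes "pos_def A"
  shows "pos_def (matrix_inv A)"
proof -
  note inv = matrix_inv_vector[OF pos_def_invertible[OF assms]]
  have "(matrix_inv A *v x) \<bullet> y = x \<bullet> (matrix_inv A *v y)" for x y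
    using symmetric_matrix_selfadjoint[OF pos_def_symmetric[OF assms],
        of "matrix_inv A *v x" "matrix_inv A *v y"] by (simp add: inv)
  then have "transpose (matrix_inv A) = matrix_inv A"
    by (rule selfadjoint_matrix_symmetric)
  moreover have "0 < x \<bullet> (matrix_inv A *v x)" if "x \<noteq> 0" for x
  proof -
    have "matrix_inv A *v x \<noteq> 0"
      by (metis inv(1) matrix_vector_mult_0_right that)
    from pos_def_pos[OF assms this] show ?thesis by (simp add: inv inner_commute)
  qed
  ultimately show ?thesis by (simp add: pos_def_def)
qed

text \<open>Existence and uniqueness of the root discharge the definite description in
  \<open>inv_sqrt\<close>.\<close>

lemma inv_sqrt:
  assumes "pos_def A"
  shows "pos_def (inv_sqrt A)" "inv_sqrt A ** inv_sqrt A = matrix_inv A"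
proof -
  have "\<exists>!B. pos_def B \<and> B ** B = matrix_inv A"
    using pos_def_sqrt_exists[OF pos_def_matrix_inv[OF assms]] pos_def_sqrt_unique by metis
  from theI'[OF this] show "pos_def (inv_sqrt A)" "inv_sqrt A ** inv_sqrt A = matrix_inv A"
    by (auto simp: inv_sqrt_def)
qed

text \<open>Removes the square root from every Gram matrix of standardised vectors, leaving only the
  inner product given by the inverse of \<open>A\<close>.\<close>

lemma inv_sqrt_inner:
  assumes "pos_def A"
  shows "(inv_sqrt A *v x) \<bullet> (inv_sqrt A *v y) = x \<bullet> (matrix_inv A *v y)"
  by (simp add: symmetric_matrix_selfadjoint[OF pos_def_symmetric[OF inv_sqrt(1)[OF assms]]]
      matrix_vector_mul_assoc inv_sqrt(2)[OF assms])

section \<open>Orthogonal maps with prescribed values\<close>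

definition householder :: "'a::real_inner \<Rightarrow> 'a \<Rightarrow> 'a" where
  "householder v x = x - (2 * (v \<bullet> x) / (v \<bullet> v)) *\<^sub>R v"

text \<open>For \<open>v = 0\<close> division by zero makes \<open>householder v\<close> the identity, so no case
  distinction is needed below.\<close>

lemma householder_orthogonal: "orthogonal_transformation (householder v)"
proof -
  have "linear (householder v)"
    by (rule linearI)
      (simp_all add: householder_def inner_simps algebra_simps add_divide_distrib)
  moreover have "householder v x \<bullet> householder v y = x \<bullet> y" for x y
    by (cases "v = 0") (simp_all add: householder_def inner_simps inner_commute)
  ultimately show ?thesis by (simp add: orthogonal_transformation_def)
qed

lemma householder_fix: "v \<bullet> x = 0 \<Longrightarrow> householder v x = x"
  by (simp add: householder_def)

text \<open>For vectors of equal length, \<open>x - y\<close> is normal to the hyperplane through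
  the origin that bisects them.\<close>

lemma householder_swap:
  assumes "x \<bullet> x = y \<bullet> y"
  shows "householder (x - y) x = y"
proof (cases "x = y")
  case False
  then have "(x - y) \<bullet> (x - y) \<noteq> 0" by simp
  \<comment> \<open>The reflection coefficient is therefore 1, so exactly \<open>x - y\<close> is
    subtracted from \<open>x\<close>.\<close>
  moreover have "2 * ((x - y) \<bullet> x) = (x - y) \<bullet> (x - y)"
    using assms by (simp add: inner_simps inner_commute)
  ultimately show ?thesis by (simp add: householder_def)
qed (simp add: householder_def)

text \<open>The first reflection sends \<open>s\<close> to \<open>s'\<close>. The second sends the
  image of \<open>t\<close> to \<open>t'\<close> and keeps \<open>s'\<close> fixed, since its normal
  is orthogonal to \<open>s'\<close> by equality of the mixed inner products.\<close>

lemma orthogonal_transformation_of_gram_eq: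
  fixes s t s' t' :: "'a::real_inner"
  assumes "s \<bullet> s = s' \<bullet> s'" "s \<bullet> t = s' \<bullet> t'" "t \<bullet> t = t' \<bullet> t'"
  obtains f where "orthogonal_transformation f" "f s = s'" "f t = t'"
proof
  let ?h = "householder (s - s')"
  let ?k = "householder (?h t - t')"
  have h: "?h x \<bullet> ?h y = x \<bullet> y" for x y
    using householder_orthogonal[of "s - s'"] by (simp add: orthogonal_transformation_def)
  show "orthogonal_transformation (?k \<circ> ?h)"
    by (intro orthogonal_transformation_compose householder_orthogonal)
  have hs: "?h s = s'" by (rule householder_swap) (rule assms)
  have "(?h t - t') \<bullet> s' = 0"
    using h[of s t] assms(2) by (simp add: hs inner_simps inner_commute)
  then show "(?k \<circ> ?h) s = s'" by (simp add: hs householder_fix)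
  show "(?k \<circ> ?h) t = t'"
    by (simp add: householder_swap h assms(3))
qed

section \<open>Group actions and maximal invariants\<close>

text \<open>Obtains the library's homomorphism into \<open>BijGroup E\<close> from the usual action
  laws on \<open>E\<close>; the inverse group element provides the inverse of each map.\<close>

lemma group_action_restrict:
  assumes G: "group G"
    and closed: "\<And>g x. g \<in> carrier G \<Longrightarrow> x \<in> E \<Longrightarrow> f g x \<in> E"
    and one: "\<And>x. x \<in> E \<Longrightarrow> f \<one>\<^bsub>G\<^esub> x = x"
    and mult: "\<And>g h x. g \<in> carrier G \<Longrightarrow> h \<in> carrier G \<Longrightarrow> x \<in> E \<Longrightarrow>
      f (g \<otimes>\<^bsub>G\<^esub> h) x = f g (f h x)"
  shows "group_action G E (\<lambda>g. restrict (f g) E)"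
proof -
  interpret G: group G by (rule G)
  have bij: "restrict (f g) E \<in> Bij E" if g: "g \<in> carrier G" for g
  proof -
    have i: "inv\<^bsub>G\<^esub> g \<in> carrier G" using g by simp
    have "bij_betw (f g) E E"
      by (rule bij_betw_byWitness[where f' = "f (inv\<^bsub>G\<^esub> g)"])
        (auto simp: mult[symmetric] g i one closed)
    then show ?thesis by (simp add: Bij_def bij_betw_restrict_eq)
  qed
  have "(\<lambda>g. restrict (f g) E) \<in> hom G (BijGroup E)"
  proof (rule homI)
    fix g h assume gh: "g \<in> carrier G" "h \<in> carrier G"
    show "restrict (f (g \<otimes>\<^bsub>G\<^esub> h)) E = restrict (f g) E \<otimes>\<^bsub>BijGroup E\<^esub> restrict (f h) E"
      using gh bij by (auto simp: BijGroup_def compose_def mult closed fun_eq_iff)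
  qed (simp add: BijGroup_def bij)
  then show ?thesis
    by (simp add: group_action_def group_hom_def group_hom_axioms_def G group_BijGroup)
qed

lemma constant_on_orbitsI:
  assumes "\<And>x g. x \<in> E \<Longrightarrow> g \<in> carrier G \<Longrightarrow> f (\<phi> g x) = f x"
  shows "constant_on_orbits G E \<phi> f"
  using assms by (force simp: constant_on_orbits_def orbits_def orbit_def)

text \<open>One direction of the equivalence gives constancy on orbits. By the other, points of two
  orbits with equal values are linked by the group, so the orbits meet and hence coincide.\<close>

lemma maximal_invariantI:
  assumes "group_action G E \<phi>"
    and eq_iff: "\<And>x y. x \<in> E \<Longrightarrow> y \<in> E \<Longrightarrow> f x = f y \<longleftrightarrow> (\<exists>g\<in>carrier G. \<phi> g x = y)"
  shows "maximal_invariant G E \<phi> f"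
proof -
  interpret group_action G E \<phi> by fact
  have "constant_on_orbits G E \<phi> f"
    by (rule constant_on_orbitsI) (metis eq_iff element_image)
  moreover have "X = Y"
    if X: "X \<in> orbits G E \<phi>" and Y: "Y \<in> orbits G E \<phi>" and x: "x \<in> X" and y: "y \<in> Y"
      and eq: "f x = f y" for X Y x y
  proof -
    have xE: "x \<in> E" "y \<in> E" using X Y x y orbits_coverture by blast+
    then obtain g where g: "g \<in> carrier G" "\<phi> g x = y" using eq_iff eq by blast
    obtain z where z: "z \<in> E" "X = orbit G \<phi> z" using X by (auto simp: orbits_def)
    then obtain h where "h \<in> carrier G" "\<phi> h z = x" using x by (auto simp: orbit_def)
    \<comment> \<open>Here \<open>y\<close> is the image of the base point \<open>z\<close> under
      the product of \<open>g\<close> and \<open>h\<close>.\<close>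
    then have "y \<in> X" using z g
      by (smt (verit) composition_rule group_hom group_hom_def group.is_monoid mem_Collect_eq monoid.m_closed
          orbit_def)
    then show "X = Y" using disjoint_union[OF X Y] y by blast
  qed
  ultimately show ?thesis unfolding maximal_invariant_def by blast
qed

section \<open>The general linear group and its two actions\<close>

lemma GL_simps:
  "carrier GL = {g. invertible g}" "g \<otimes>\<^bsub>GL\<^esub> h = g ** h" "\<one>\<^bsub>GL\<^esub> = mat 1"
  by (simp_all add: GL_def)

lemma group_GL: "group (GL :: (real^'k^'k) monoid)"
proof (rule groupI)
  show "\<one>\<^bsub>GL\<^esub> \<in> carrier (GL :: (real^'k^'k) monoid)"
    by (auto simp: GL_simps invertible_def)
  fix g :: "real^'k^'k" assume "g \<in> carrier GL"
  then show "\<exists>y\<in>carrier GL. y \<otimes>\<^bsub>GL\<^esub> g = \<one>\<^bsub>GL\<^esub>"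
    by (intro bexI[of _ "matrix_inv g"])
      (simp_all add: GL_simps matrix_inv_inverse invertible_matrix_inv)
qed (auto simp: GL_simps invertible_mult matrix_mul_assoc)

lemma group_action_sample:
  "group_action GL (sample_space :: 'k::finite sample set) sample_action"
proof -
  have eq: "sample_action = (\<lambda>g. restrict (\<lambda>(R0, \<Omega>0, \<Phi>). (g ** R0, \<Omega>0, g ** \<Phi> ** transpose g))
      (sample_space :: 'k sample set))"
    by (simp add: sample_action_def fun_eq_iff)
  show ?thesis
    unfolding eq by (rule group_action_restrict[OF group_GL])
      (auto simp: GL_simps sample_space_def pos_def_congruence matrix_mul_assoc matrix_transpose_mul)
qed

text \<open>Kept general in \<open>E\<close> so as to cover both the full parameter space and the
  one with nonzero \<open>\<mu>\<close>.\<close>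

lemma group_action_param:
  assumes "\<And>g \<theta>. invertible g \<Longrightarrow> \<theta> \<in> E \<Longrightarrow> param_map g \<theta> \<in> E"
  shows "group_action GL E (param_action_on E)"
proof -
  have eq: "param_action_on E = (\<lambda>g. restrict (param_map g) E)"
    by (simp add: param_action_on_def fun_eq_iff)
  show ?thesis
    unfolding eq by (rule group_action_restrict[OF group_GL])
      (use assms in \<open>auto simp: GL_simps param_map_def
        matrix_mul_assoc matrix_transpose_mul matrix_vector_mul_assoc\<close>)
qed

section \<open>The sample space\<close>

lemma invertible_B0: "invertible (B0 \<beta>0)"
  by (simp add: invertible_det_nz det_2 B0_def)

text \<open>The group multiplies from the left and the change of coordinates from the right.\<close>

lemma R_of_mult: "R_of \<beta>0 (g ** R) = g ** R_of \<beta>0 R"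
  by (simp add: R_of_def matrix_mul_assoc)

lemma R_of_B0: "R_of \<beta>0 (R ** B0 \<beta>0) = R"
  by (simp add: R_of_def matrix_mul_assoc[symmetric] matrix_inv_inverse[OF invertible_B0])

lemma R_of_eq_iff: "R_of \<beta>0 R = R_of \<beta>0 R' \<longleftrightarrow> R = R'"
proof -
  have "R_of \<beta>0 R ** B0 \<beta>0 = R" for R :: "real^2^'k"
    by (simp add: R_of_def matrix_mul_assoc[symmetric] matrix_inv_inverse[OF invertible_B0])
  then show ?thesis by metis
qed

lemma pos_def_Omega_of: "pos_def \<Omega>0 \<Longrightarrow> pos_def (Omega_of \<beta>0 \<Omega>0)"
  using pos_def_congruence[of \<Omega>0 "transpose (matrix_inv (B0 \<beta>0))"]
  by (simp add: Omega_of_def transpose_invertible invertible_matrix_inv invertible_B0)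

lemma a_vec_nonzero: "a_vec \<beta> \<noteq> 0"
  by (metis a_vec_def vector_2(2) zero_index zero_neq_one)

lemma b_vec_nonzero: "b_vec \<beta> \<noteq> 0"
  by (metis b_vec_def vector_2(1) zero_index zero_neq_one)

lemma matrix_eq_on_b_vec_a_vec:
  fixes R R' :: "real^2^'k"
  assumes pd: "pos_def \<Omega>"
    and b: "R *v b_vec \<beta> = R' *v b_vec \<beta>"
    and a: "R *v (matrix_inv \<Omega> *v a_vec \<beta>) = R' *v (matrix_inv \<Omega> *v a_vec \<beta>)"
  shows "R = R'"
proof -
  have "R $ i = R' $ i" for i
  proof -
    define r where "r = R $ i - R' $ i"
    have rb: "r \<bullet> b_vec \<beta> = 0"
      using arg_cong[OF b, of "\<lambda>v. v $ i"]
      by (simp add: r_def inner_diff_left matrix_vector_mul_component)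
    have ra: "r \<bullet> (matrix_inv \<Omega> *v a_vec \<beta>) = 0"
      using arg_cong[OF a, of "\<lambda>v. v $ i"]
      by (simp add: r_def inner_diff_left matrix_vector_mul_component)
    \<comment> \<open>In the plane, the orthogonal complement of \<open>b_vec \<beta>\<close> is the
      line through \<open>a_vec \<beta>\<close>.\<close>
    have r: "r = r $ 2 *\<^sub>R a_vec \<beta>"
      using rb by (simp add: vec_eq_iff forall_2 a_vec_def b_vec_def inner_vec_def sum_2)
    have "r $ 2 * (a_vec \<beta> \<bullet> (matrix_inv \<Omega> *v a_vec \<beta>)) = 0"
      using ra by (metis inner_scaleR_left r)
    moreover have "0 < a_vec \<beta> \<bullet> (matrix_inv \<Omega> *v a_vec \<beta>)"
      by (rule pos_def_pos[OF pos_def_matrix_inv[OF pd] a_vec_nonzero])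
    ultimately have "r $ 2 = 0" by simp
    then have "r = 0" using r by simp
    then show ?thesis by (simp add: r_def)
  qed
  then show ?thesis by (simp add: vec_eq_iff)
qed

section \<open>The Gram matrix \<open>Q\<close> and its behaviour under the group\<close>

lemma Q_stat_nth:
  "Q_stat \<beta>0 R \<Omega> \<Phi> $ 1 $ 1 = S_stat \<beta>0 R \<Omega> \<Phi> \<bullet> S_stat \<beta>0 R \<Omega> \<Phi>"
  "Q_stat \<beta>0 R \<Omega> \<Phi> $ 1 $ 2 = S_stat \<beta>0 R \<Omega> \<Phi> \<bullet> T_stat \<beta>0 R \<Omega> \<Phi>"
  "Q_stat \<beta>0 R \<Omega> \<Phi> $ 2 $ 1 = S_stat \<beta>0 R \<Omega> \<Phi> \<bullet> T_stat \<beta>0 R \<Omega> \<Phi>"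
  "Q_stat \<beta>0 R \<Omega> \<Phi> $ 2 $ 2 = T_stat \<beta>0 R \<Omega> \<Phi> \<bullet> T_stat \<beta>0 R \<Omega> \<Phi>"
  by (simp_all add: Q_stat_def ST_stat_def matrix_matrix_mult_def transpose_def inner_vec_def
      mult.commute)

lemma Q_stat_eq_iff:
  "Q_stat \<beta>0 R \<Omega> \<Phi> = Q_stat \<beta>0 R' \<Omega>' \<Phi>' \<longleftrightarrow>
    S_stat \<beta>0 R \<Omega> \<Phi> \<bullet> S_stat \<beta>0 R \<Omega> \<Phi> = S_stat \<beta>0 R' \<Omega>' \<Phi>' \<bullet> S_stat \<beta>0 R' \<Omega>' \<Phi>' \<and>
    S_stat \<beta>0 R \<Omega> \<Phi> \<bullet> T_stat \<beta>0 R \<Omega> \<Phi> = S_stat \<beta>0 R' \<Omega>' \<Phi>' \<bullet> T_stat \<beta>0 R' \<Omega>' \<Phi>' \<and>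
    T_stat \<beta>0 R \<Omega> \<Phi> \<bullet> T_stat \<beta>0 R \<Omega> \<Phi> = T_stat \<beta>0 R' \<Omega>' \<Phi>' \<bullet> T_stat \<beta>0 R' \<Omega>' \<Phi>'"
  by (auto simp: vec_eq_iff[of "Q_stat _ _ _ _"] vec_eq_iff[of "Q_stat _ _ _ _ $ _"] forall_2 Q_stat_nth)

lemma matrix_inv_congruence_inner:
  fixes \<Phi> g :: "real^'k^'k"
  assumes \<Phi>: "pos_def \<Phi>" and g: "invertible g"
  shows "(g *v x) \<bullet> (matrix_inv (g ** \<Phi> ** transpose g) *v (g *v y)) = x \<bullet> (matrix_inv \<Phi> *v y)"
proof -
  \<comment> \<open>The value that the inverse of \<open>g ** \<Phi> ** transpose g\<close> must
    take at \<open>g *v y\<close>, by the rule for inverting a product.\<close>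
  let ?z = "matrix_inv (transpose g) *v (matrix_inv \<Phi> *v y)"
  have gz: "transpose g *v ?z = matrix_inv \<Phi> *v y"
    by (rule matrix_inv_vector(1)[OF transpose_invertible[OF g]])
  have "(g ** \<Phi> ** transpose g) *v ?z = g *v (\<Phi> *v (transpose g *v ?z))"
    by (simp only: matrix_vector_mul_assoc matrix_mul_assoc)
  also have "\<dots> = g *v y"
    by (simp only: gz matrix_inv_vector(1)[OF pos_def_invertible[OF \<Phi>]])
  finally have "matrix_inv (g ** \<Phi> ** transpose g) *v (g *v y) = ?z"
    by (metis matrix_inv_vector(2) pos_def_congruence[OF \<Phi> g] pos_def_invertible)
  then have "(g *v x) \<bullet> (matrix_inv (g ** \<Phi> ** transpose g) *v (g *v y)) = ?z \<bullet> (g *v x)"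
    by (simp add: inner_commute)
  also have "\<dots> = (transpose g *v ?z) \<bullet> x"
    by (simp add: dot_lmul_matrix)
  finally show ?thesis by (simp only: gz inner_commute)
qed

text \<open>The entries of \<open>Q\<close> are inner products with respect to the inverse of
  \<open>\<Phi>\<close>, which the congruence preserves.\<close>

lemma Q_stat_invariant:
  fixes \<Phi> g :: "real^'k^'k"
  assumes "pos_def \<Phi>" "invertible g"
  shows "Q_stat \<beta>0 (g ** R) \<Omega> (g ** \<Phi> ** transpose g) = Q_stat \<beta>0 R \<Omega> \<Phi>"
  using matrix_inv_congruence_inner[OF assms]
  by (simp add: Q_stat_eq_iff S_stat_def T_stat_def matrix_vector_mul_assoc[symmetric]
      inv_sqrt_inner assms pos_def_congruence)

text \<open>\<open>g\<close> standardises by \<open>\<Phi>\<close>, rotates by \<open>U\<close>,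
  then applies the square root of \<open>\<Psi>\<close>; the middle factors of the congruence
  cancel, leaving that root squared.\<close>

lemma inv_sqrt_orthogonal_congruence:
  fixes \<Phi> \<Psi> U :: "real^'k^'k"
  assumes \<Phi>: "pos_def \<Phi>" and \<Psi>: "pos_def \<Psi>" and U: "orthogonal_matrix U"
    and g: "g = matrix_inv (inv_sqrt \<Psi>) ** U ** inv_sqrt \<Phi>"
  shows "invertible g" "g ** \<Phi> ** transpose g = \<Psi>"
proof -
  let ?P = "inv_sqrt \<Phi>" and ?N = "matrix_inv (inv_sqrt \<Psi>)"
  note P = inv_sqrt(1)[OF \<Phi>] and N = pos_def_matrix_inv[OF inv_sqrt(1)[OF \<Psi>]]
  have "invertible U" using U by (auto simp: orthogonal_matrix_def invertible_def)
  then show "invertible g"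
    unfolding g by (intro invertible_mult pos_def_invertible[OF P] pos_def_invertible[OF N])
  have "?P ** (?P ** \<Phi>) = mat 1"
    by (simp add: matrix_mul_assoc inv_sqrt(2)[OF \<Phi>] matrix_inv_inverse pos_def_invertible \<Phi>)
  then have P1: "?P ** \<Phi> ** ?P = mat 1"
    using matrix_left_right_inverse by blast
  \<comment> \<open>Shows that \<open>?N\<close> is a square root of \<open>\<Psi>\<close>, by
    splitting \<open>matrix_inv \<Psi>\<close> into two factors
    \<open>inv_sqrt \<Psi>\<close>.\<close>
  have "?N ** ?N ** matrix_inv \<Psi> = ?N ** (?N ** inv_sqrt \<Psi>) ** inv_sqrt \<Psi>"
    by (simp only: inv_sqrt(2)[OF \<Psi>, symmetric] matrix_mul_assoc)
  also have "\<dots> = mat 1"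
    by (simp add: matrix_inv_inverse pos_def_invertible[OF inv_sqrt(1)[OF \<Psi>]])
  finally have "?N ** ?N = \<Psi>"
    by (metis matrix_inv_unique matrix_inv_inverse(1) \<Psi> pos_def_invertible)
  have "g ** \<Phi> ** transpose g = ?N ** U ** (?P ** \<Phi> ** ?P) ** transpose U ** ?N"
    by (simp add: g matrix_transpose_mul pos_def_symmetric[OF P] pos_def_symmetric[OF N]
        matrix_mul_assoc)
  also have "\<dots> = ?N ** (U ** transpose U) ** ?N"
    by (simp add: P1 matrix_mul_assoc)
  also have "\<dots> = \<Psi>"
    using U \<open>?N ** ?N = \<Psi>\<close> by (simp add: orthogonal_matrix_def)
  finally show "g ** \<Phi> ** transpose g = \<Psi>" .
qed

text \<open>Equal Gram matrices give an orthogonal map carrying the pair (S, T) of \<open>R\<close>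
  to that of \<open>R'\<close>. Conjugated by the square roots, it matches the two matrices on
  \<open>b_vec \<beta>0\<close> and \<open>matrix_inv \<Omega> *v a_vec \<beta>0\<close>, which
  determines them.\<close>

lemma Q_stat_eq_imp_congruent:
  fixes R R' :: "real^2^'k"
  assumes \<Omega>: "pos_def \<Omega>" and \<Phi>: "pos_def \<Phi>" and \<Psi>: "pos_def \<Psi>"
    and eq: "Q_stat \<beta>0 R \<Omega> \<Phi> = Q_stat \<beta>0 R' \<Omega> \<Psi>"
  obtains g where "invertible g" "g ** R = R'" "g ** \<Phi> ** transpose g = \<Psi>"
proof -
  obtain f where f: "orthogonal_transformation f"
      "f (S_stat \<beta>0 R \<Omega> \<Phi>) = S_stat \<beta>0 R' \<Omega> \<Psi>" "f (T_stat \<beta>0 R \<Omega> \<Phi>) = T_stat \<beta>0 R' \<Omega> \<Psi>"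
    using eq by (auto simp: Q_stat_eq_iff intro: orthogonal_transformation_of_gram_eq)
  have lin: "linear f" and U: "orthogonal_matrix (matrix f)"
    using f(1) by (auto simp: orthogonal_transformation_matrix)
  have mat: "matrix f *v x = f x" for x
    using lin by (simp add: matrix_works)
  define g where "g = matrix_inv (inv_sqrt \<Psi>) ** matrix f ** inv_sqrt \<Phi>"
  have conj: "g *v (R *v x) = R' *v x"
    if "f (inv_sqrt \<Phi> *v (R *v x)) = inv_sqrt \<Psi> *v (R' *v x)" for x
  proof -
    have "g *v (R *v x) = matrix_inv (inv_sqrt \<Psi>) *v (matrix f *v (inv_sqrt \<Phi> *v (R *v x)))"
      by (simp only: g_def matrix_vector_mul_assoc matrix_mul_assoc)
    also have "\<dots> = R' *v x"
      by (simp only: mat that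
          matrix_inv_vector(2)[OF pos_def_invertible[OF inv_sqrt(1)[OF \<Psi>]]])
    finally show ?thesis .
  qed
  \<comment> \<open>The normalising factor of \<open>S_stat\<close> is nonzero and depends only on
    the common \<open>\<Omega>\<close>, so it cancels; the same holds below for
    \<open>T_stat\<close>.\<close>
  have "g *v (R *v b_vec \<beta>0) = R' *v b_vec \<beta>0"
    using f(2) pos_def_pos[OF \<Omega> b_vec_nonzero, of \<beta>0]
    by (intro conj) (simp add: S_stat_def linear_scale[OF lin])
  moreover have "g *v (R *v (matrix_inv \<Omega> *v a_vec \<beta>0)) = R' *v (matrix_inv \<Omega> *v a_vec \<beta>0)"
    using f(3) pos_def_pos[OF pos_def_matrix_inv[OF \<Omega>] a_vec_nonzero, of \<beta>0]
    by (intro conj) (simp add: T_stat_def linear_scale[OF lin])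
  ultimately have "g ** R = R'"
    by (intro matrix_eq_on_b_vec_a_vec[OF \<Omega>]) (simp_all only: matrix_vector_mul_assoc matrix_mul_assoc)
  then show ?thesis
    using that inv_sqrt_orthogonal_congruence[OF \<Phi> \<Psi> U g_def] by blast
qed

lemma sample_invariant_eq_iff:
  assumes x: "x \<in> sample_space" and y: "y \<in> sample_space"
  shows "sample_invariant \<beta>0 x = sample_invariant \<beta>0 y \<longleftrightarrow>
    (\<exists>g\<in>carrier GL. sample_action g x = y)"
proof -
  obtain R \<Omega> \<Phi> where x': "x = (R, \<Omega>, \<Phi>)" "pos_def \<Omega>" "pos_def \<Phi>"
    using x by (auto simp: sample_space_def)
  obtain R' \<Omega>' \<Psi> where y': "y = (R', \<Omega>', \<Psi>)" "pos_def \<Psi>"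
    using y by (auto simp: sample_space_def)
  have act: "sample_action g (R, \<Omega>, \<Phi>) = (g ** R, \<Omega>, g ** \<Phi> ** transpose g)" for g
    using x by (simp add: sample_action_def x'(1))
  show ?thesis
  proof
    assume "sample_invariant \<beta>0 x = sample_invariant \<beta>0 y"
    then have \<Omega>': "\<Omega>' = \<Omega>"
      and "Q_stat \<beta>0 (R_of \<beta>0 R) (Omega_of \<beta>0 \<Omega>) \<Phi> = Q_stat \<beta>0 (R_of \<beta>0 R') (Omega_of \<beta>0 \<Omega>) \<Psi>"
      by (auto simp: sample_invariant_def x' y')
    then obtain g where "invertible g" "g ** R_of \<beta>0 R = R_of \<beta>0 R'" "g ** \<Phi> ** transpose g = \<Psi>"
      using Q_stat_eq_imp_congruent[OF pos_def_Omega_of[OF x'(2)] x'(3) y'(2)] by metis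
    then show "\<exists>g\<in>carrier GL. sample_action g x = y"
      by (auto simp: act x'(1) y'(1) \<Omega>' GL_simps R_of_mult[symmetric] R_of_eq_iff)
  next
    assume "\<exists>g\<in>carrier GL. sample_action g x = y"
    then show "sample_invariant \<beta>0 x = sample_invariant \<beta>0 y"
      by (auto simp: act x'(1) y'(1) GL_simps sample_invariant_def R_of_mult
          Q_stat_invariant x'(3))
  qed
qed

section \<open>The parameter space\<close>

text \<open>The mean of \<open>R0\<close> in the model, that is, the first component of
  \<open>data_law_spec\<close>.\<close>

definition mean_matrix :: "real \<Rightarrow> real^'k \<Rightarrow> real^2^'k" where
  "mean_matrix \<Delta> \<mu> = (\<chi> i j. \<mu> $ i * (vector [\<Delta>, 1] :: real^2) $ j)"

lemma data_law_spec_eq: "data_law_spec (\<Delta>, \<mu>, \<Omega>0, \<Phi>) = (mean_matrix \<Delta> \<mu>, \<Omega>0, \<Phi>)"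
  by (simp add: data_law_spec_def mean_matrix_def)

lemma mean_matrix_mult: "g ** mean_matrix \<Delta> \<mu> = mean_matrix \<Delta> (g *v \<mu>)"
  by (simp add: mean_matrix_def matrix_matrix_mult_def matrix_vector_mult_def vec_eq_iff
      sum_distrib_right mult.assoc)

lemma R_of_mean_matrix:
  fixes \<mu> :: "real^'k"
  shows "R_of \<beta>0 (mean_matrix \<Delta> \<mu>) *v y = (a_vec (\<beta>0 + \<Delta>) \<bullet> y) *\<^sub>R \<mu>"
proof -
  \<comment> \<open>The mean of \<open>R\<close> itself, the outer product of \<open>\<mu>\<close>
    and \<open>a_vec \<beta>\<close>; multiplying the row (\<beta>, 1) by \<open>B0 \<beta>0\<close>
    gives (\<Delta>, 1).\<close>
  let ?N = "(\<chi> i j. \<mu> $ i * a_vec (\<beta>0 + \<Delta>) $ j) :: real^2^'k"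
  have "mean_matrix \<Delta> \<mu> = ?N ** B0 \<beta>0"
    by (simp add: mean_matrix_def B0_def a_vec_def matrix_matrix_mult_def vec_eq_iff forall_2
        sum_2 algebra_simps)
  then have "R_of \<beta>0 (mean_matrix \<Delta> \<mu>) = ?N"
    by (simp only: R_of_B0)
  then show ?thesis
    by (simp add: matrix_vector_mult_def vec_eq_iff inner_vec_def sum_distrib_left mult_ac)
qed

lemma S_stat_mean_matrix:
  "S_stat \<beta>0 (R_of \<beta>0 (mean_matrix \<Delta> \<mu>)) \<Omega> \<Phi> =
    c_par \<beta>0 (\<beta>0 + \<Delta>) \<Omega> *\<^sub>R (inv_sqrt \<Phi> *v \<mu>)"
proof -
  have "a_vec (\<beta>0 + \<Delta>) \<bullet> b_vec \<beta>0 = \<Delta>"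
    by (simp add: a_vec_def b_vec_def inner_vec_def sum_2)
  then show ?thesis
    by (simp add: S_stat_def c_par_def R_of_mean_matrix matrix_vector_mult_scaleR)
qed

lemma T_stat_mean_matrix:
  "T_stat \<beta>0 (R_of \<beta>0 (mean_matrix \<Delta> \<mu>)) \<Omega> \<Phi> =
    d_par \<beta>0 (\<beta>0 + \<Delta>) \<Omega> *\<^sub>R (inv_sqrt \<Phi> *v \<mu>)"
  by (simp add: T_stat_def d_par_def R_of_mean_matrix matrix_vector_mult_scaleR)

text \<open>At the mean matrix, S and T are \<open>c\<close> and \<open>d\<close> times the
  standardised \<open>\<mu>\<close>, whose squared length is \<lambda>; the entries of
  \<open>Q\<close> there are the first three components of \<open>param_invariant\<close>.\<close>

lemma param_invariant_eq_iff_sample_invariant: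
  assumes "\<theta> \<in> param_space" "\<theta>' \<in> param_space"
  shows "param_invariant \<beta>0 \<theta> = param_invariant \<beta>0 \<theta>' \<longleftrightarrow>
    sample_invariant \<beta>0 (data_law_spec \<theta>) = sample_invariant \<beta>0 (data_law_spec \<theta>')"
proof -
  obtain \<Delta> \<mu> \<Omega> \<Phi> where \<theta>: "\<theta> = (\<Delta>, \<mu>, \<Omega>, \<Phi>)" "pos_def \<Phi>"
    using assms(1) by (auto simp: param_space_def)
  obtain \<Delta>' \<mu>' \<Omega>' \<Phi>' where \<theta>': "\<theta>' = (\<Delta>', \<mu>', \<Omega>', \<Phi>')" "pos_def \<Phi>'"
    using assms(2) by (auto simp: param_space_def)
  show ?thesis
    by (cases "\<Omega> = \<Omega>'")
      (simp_all add: \<theta> \<theta>' data_law_spec_eq sample_invariant_def param_invariant_def Let_def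
        Q_stat_eq_iff S_stat_mean_matrix T_stat_mean_matrix inv_sqrt_inner lambda_par_def
        power2_eq_square mult_ac)
qed

lemma data_law_spec_in_sample_space: "\<theta> \<in> param_space \<Longrightarrow> data_law_spec \<theta> \<in> sample_space"
  by (auto simp: param_space_def sample_space_def data_law_spec_eq)

lemma data_law_spec_param_map:
  "\<theta> \<in> param_space \<Longrightarrow> data_law_spec (param_map g \<theta>) = sample_action g (data_law_spec \<theta>)"
  by (auto simp: param_space_def sample_space_def data_law_spec_eq param_map_def
      sample_action_def mean_matrix_mult)

text \<open>The sample space result applied at the mean matrices. It compares laws rather than
  parameters, which accommodates the unidentified \<open>\<Delta>\<close> at
  \<open>\<mu> = 0\<close>.\<close>

lemma param_invariant_eq_iff:
  assumes "\<theta> \<in> param_space" "\<theta>' \<in> param_space"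
  shows "param_invariant \<beta>0 \<theta> = param_invariant \<beta>0 \<theta>' \<longleftrightarrow>
    (\<exists>g\<in>carrier GL. data_law_spec (param_map g \<theta>) = data_law_spec \<theta>')"
  using assms
  by (simp add: param_invariant_eq_iff_sample_invariant sample_invariant_eq_iff
      data_law_spec_in_sample_space data_law_spec_param_map)

text \<open>The second column of the mean matrix is \<open>\<mu>\<close>; a nonzero coordinate of it
  then gives \<open>\<Delta>\<close> from the first column.\<close>

lemma inj_on_data_law_spec:
  "inj_on data_law_spec (param_space_nonzero :: 'k::finite param set)"
proof (rule inj_onI)
  fix \<theta> \<theta>' :: "'k param"
  assume \<theta>: "\<theta> \<in> param_space_nonzero" "\<theta>' \<in> param_space_nonzero"
    and eq: "data_law_spec \<theta> = data_law_spec \<theta>'"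
  obtain \<Delta> \<mu> \<Omega> \<Phi> where t: "\<theta> = (\<Delta>, \<mu>, \<Omega>, \<Phi>)" "\<mu> \<noteq> 0"
    using \<theta> by (auto simp: param_space_nonzero_def)
  obtain \<Delta>' \<mu>' \<Omega>' \<Phi>' where t': "\<theta>' = (\<Delta>', \<mu>', \<Omega>', \<Phi>')"
    by (cases \<theta>')
  have mm: "mean_matrix \<Delta> \<mu> = mean_matrix \<Delta>' \<mu>'"
    using eq by (simp add: t t' data_law_spec_eq)
  have m: "\<mu> $ i * \<Delta> = \<mu>' $ i * \<Delta>'" "\<mu> $ i = \<mu>' $ i" for i
    using arg_cong[OF mm, of "\<lambda>M. M $ i $ 1"] arg_cong[OF mm, of "\<lambda>M. M $ i $ 2"]
    unfolding mean_matrix_def by simp_all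
  obtain i where "\<mu> $ i \<noteq> 0" using t(2) by (auto simp: vec_eq_iff)
  then have "\<Delta> = \<Delta>'" using m[of i] by simp
  moreover have "\<mu> = \<mu>'" using m by (simp add: vec_eq_iff)
  ultimately show "\<theta> = \<theta>'" using eq by (simp add: t t' data_law_spec_eq)
qed

lemma param_map_in_param_space:
  "invertible g \<Longrightarrow> \<theta> \<in> param_space \<Longrightarrow> param_map g \<theta> \<in> param_space"
  by (auto simp: param_space_def param_map_def pos_def_congruence)

lemma param_map_in_param_space_nonzero:
  assumes "invertible g" "\<theta> \<in> param_space_nonzero"
  shows "param_map g \<theta> \<in> param_space_nonzero"
proof -
  obtain \<Delta> \<mu> \<Omega> \<Phi> where \<theta>: "\<theta> = (\<Delta>, \<mu>, \<Omega>, \<Phi>)" "\<mu> \<noteq> 0" "pos_def \<Omega>" "pos_def \<Phi>"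
    using assms(2) by (auto simp: param_space_nonzero_def)
  have "g *v \<mu> \<noteq> 0"
    by (metis assms(1) \<theta>(2) matrix_inv_vector(2) matrix_vector_mult_0_right)
  then show ?thesis
    using pos_def_congruence[OF \<theta>(4) assms(1)] \<theta>(3)
    by (simp add: \<theta>(1) param_space_nonzero_def param_map_def)
qed

lemma param_space_nonzero_subset: "param_space_nonzero \<subseteq> param_space"
  by (auto simp: param_space_nonzero_def param_space_def)

text \<open>Invariance holds on the whole parameter space, maximality where \<open>\<mu>\<close> is
  nonzero. The last conjunct treats all parameters at once, by asking for group elements that match
  the laws of the data.\<close>

theorem theorem1:
  fixes \<beta>0 :: real
  shows
    "(group_action GL (sample_space :: 'k::finite sample set) sample_action \<and>
      maximal_invariant GL (sample_space :: 'k sample set) sample_action (sample_invariant \<beta>0))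
     \<and>
     (group_action GL (param_space :: 'k param set) (param_action_on param_space) \<and>
      constant_on_orbits GL (param_space :: 'k param set) (param_action_on param_space)
        (param_invariant \<beta>0) \<and>
      group_action GL (param_space_nonzero :: 'k param set) (param_action_on param_space_nonzero) \<and>
      maximal_invariant GL (param_space_nonzero :: 'k param set) (param_action_on param_space_nonzero)
        (param_invariant \<beta>0) \<and>
      (\<forall>\<theta> \<in> (param_space :: 'k param set). \<forall>\<theta>' \<in> param_space.
         param_invariant \<beta>0 \<theta> = param_invariant \<beta>0 \<theta>' \<longleftrightarrow>
         (\<exists>g \<in> carrier GL. data_law_spec (param_action_on param_space g \<theta>) = data_law_spec \<theta>')))"
proof (intro conjI ballI)
  show "group_action GL (sample_space :: 'k sample set) sample_action"
    by (rule group_action_sample)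
  then show "maximal_invariant GL (sample_space :: 'k sample set) sample_action
      (sample_invariant \<beta>0)"
    by (rule maximal_invariantI) (rule sample_invariant_eq_iff)
  show "group_action GL (param_space :: 'k param set) (param_action_on param_space)"
    by (rule group_action_param) (rule param_map_in_param_space)
  show "constant_on_orbits GL (param_space :: 'k param set) (param_action_on param_space)
      (param_invariant \<beta>0)"
  proof (rule constant_on_orbitsI)
    fix \<theta> :: "'k param" and g :: "real^'k^'k"
    assume "\<theta> \<in> param_space" "g \<in> carrier GL"
    then have "param_invariant \<beta>0 \<theta> = param_invariant \<beta>0 (param_map g \<theta>)"
      by (subst param_invariant_eq_iff) (auto simp: GL_simps param_map_in_param_space)
    then show "param_invariant \<beta>0 (param_action_on param_space g \<theta>) = param_invariant \<beta>0 \<theta>"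
      using \<open>\<theta> \<in> param_space\<close> by (simp add: param_action_on_def)
  qed
  show act: "group_action GL (param_space_nonzero :: 'k param set)
      (param_action_on param_space_nonzero)"
    by (rule group_action_param) (rule param_map_in_param_space_nonzero)
  show "maximal_invariant GL (param_space_nonzero :: 'k param set)
      (param_action_on param_space_nonzero) (param_invariant \<beta>0)"
  proof (rule maximal_invariantI[OF act])
    fix \<theta> \<theta>' :: "'k param"
    assume \<theta>: "\<theta> \<in> param_space_nonzero" "\<theta>' \<in> param_space_nonzero"
    then have "\<theta> \<in> param_space" "\<theta>' \<in> param_space"
      using param_space_nonzero_subset by blast+
    \<comment> \<open>Identification for nonzero \<open>\<mu>\<close> turns equality of laws into
      equality of parameters, since the group keeps \<open>\<mu>\<close> nonzero.\<close>
    moreover have "data_law_spec (param_map g \<theta>) = data_law_spec \<theta>' \<longleftrightarrow> param_map g \<theta> = \<theta>'"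
      if "g \<in> carrier GL" for g
      using that \<theta> by (intro inj_on_eq_iff[OF inj_on_data_law_spec])
        (auto simp: GL_simps param_map_in_param_space_nonzero)
    ultimately show "param_invariant \<beta>0 \<theta> = param_invariant \<beta>0 \<theta>' \<longleftrightarrow>
        (\<exists>g\<in>carrier GL. param_action_on param_space_nonzero g \<theta> = \<theta>')"
      using \<theta>(1) by (simp add: param_invariant_eq_iff param_action_on_def)
  qed
  show "param_invariant \<beta>0 \<theta> = param_invariant \<beta>0 \<theta>' \<longleftrightarrow>
      (\<exists>g\<in>carrier GL. data_law_spec (param_action_on param_space g \<theta>) = data_law_spec \<theta>')"
    if "\<theta> \<in> param_space" "\<theta>' \<in> param_space" for \<theta> \<theta>' :: "'k param"
    using that by (simp add: param_invariant_eq_iff param_action_on_def)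
qed

end
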